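(* Let $\Omega\subset\mathbb{D}$ be a non-empty connected open set, and let $A:\mathbb{C}[z]\rightarrow\mathfrak{A}(\mathbb{D})$ be a linear map. Then $A(\mathcal{S}(\mathbb{D}))\subset\mathcal{S}_{\mathfrak{A}}(\Omega)$ if and only if at least one of the following holds: (1) there exist a function $\psi\in\mathcal{S}_{\mathfrak{A}}(\Omega)$ and a linear functional $\nu:\mathbb{C}[z]\rightarrow\mathbb{C}$ such that $A(f)=\nu(f)\psi$ for all $f\in\mathbb{C}[z]$; or (2) there exist a function $\psi\in\mathcal{S}_{\mathfrak{A}}(\Omega)$ and a non-constant function $\varphi\in\mathfrak{A}(\mathbb{D})$ with $\varphi(\Omega)\subset\mathbb{D}$ such that $A=M_\psi C_\varphi$.
   Context: $\mathbb{D}$ is the open unit disk in $\mathbb{C}$. $\mathbb{C}[z]$ is the complex vector space of univariate complex polynomials, and $\mathfrak{A}(\mathbb{D})$ is the complex vector space of analytic functions on $\mathbb{D}$. $\mathcal{S}(\mathbb{D})\subset\mathbb{C}[z]$ is the set of all polynomials having no zeros in $\mathbb{D}$, together with the zero polynomial. For $\Omega\subset\mathbb{D}$, $\mathcal{S}_{\mathfrak{A}}(\Omega)\subset\mathfrak{A}(\mathbb{D})$ is the set of all functions in $\mathfrak{A}(\mathbb{D})$ having no zeros in $\Omega$, together with the zero function. For $\psi,\varphi\in\mathfrak{A}(\mathbb{D})$, the operator $M_\psi C_\varphi:\mathbb{C}[z]\to\mathfrak{A}(\mathbb{D})$ is the composite of $C_\varphi p=p\circ\varphi$ followed by multiplication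 $M_\psi g=\psi g$; that is, $(M_\psi C_\varphi p)(z)=\psi(z)\,p(\varphi(z))$ for $p\in\mathbb{C}[z]$, $z\in\mathbb{D}$. *)

theory Defs
  imports "HOL-Complex_Analysis.Complex_Analysis" "HOL-Library.Function_Algebras"
begin

abbreviation unit_disk :: "complex set" where
  "unit_disk \<equiv> ball 0 1"

text \<open>
  A function on the unit disk is represented by its extension by zero to the whole plane.
  This makes the representation unique, so that equality of elements of \<open>disk_analytic\<close>
  is equality of functions on the disk, and \<open>disk_analytic\<close> is a genuine linear subspace
  of the space of all functions \<open>complex \<Rightarrow> complex\<close>.
\<close>

definition disk_analytic :: "(complex \<Rightarrow> complex) set" where
  "disk_analytic = {f. f analytic_on unit_disk \<and> (\<forall>z. z \<notin> unit_disk \<longrightarrow> f z = 0)}"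

definition fun_scale :: "complex \<Rightarrow> (complex \<Rightarrow> complex) \<Rightarrow> complex \<Rightarrow> complex" where
  "fun_scale c f = (\<lambda>z. c * f z)"

definition stable_polys :: "complex poly set" where
  "stable_polys = insert 0 {p. \<forall>z\<in>unit_disk. poly p z \<noteq> 0}"

definition stable_analytic :: "complex set \<Rightarrow> (complex \<Rightarrow> complex) set" where
  "stable_analytic \<Omega> = insert 0 {f \<in> disk_analytic. \<forall>z\<in>\<Omega>. f z \<noteq> 0}"

definition comp_op :: "(complex \<Rightarrow> complex) \<Rightarrow> complex poly \<Rightarrow> complex \<Rightarrow> complex" where
  "comp_op \<phi> p = poly p \<circ> \<phi>"

definition mult_op :: "(complex \<Rightarrow> complex) \<Rightarrow> (complex \<Rightarrow> complex) \<Rightarrow> complex \<Rightarrow> complex" where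
  "mult_op \<psi> g = (\<lambda>z. \<psi> z * g z)"

lemma vector_space_fun_scale: "vector_space fun_scale"
  by unfold_locales (auto simp: fun_scale_def algebra_simps)

lemma vector_space_smult: "vector_space (smult :: complex \<Rightarrow> complex poly \<Rightarrow> complex poly)"
  by unfold_locales (auto simp: smult_add_right smult_add_left)

lemma subspace_disk_analytic: "module.subspace fun_scale disk_analytic"
proof -
  interpret vector_space fun_scale by (rule vector_space_fun_scale)
  show ?thesis
    by (rule subspaceI)
      (auto simp: disk_analytic_def fun_scale_def zero_fun_def plus_fun_def
        intro!: analytic_intros)
qed

text \<open>
  \<open>comp_op \<phi> p\<close> need not vanish outside the disk, but its product with an element of
  \<open>disk_analytic\<close> does, so the weighted composition operator has its values in
  \<open>disk_analytic\<close>.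
\<close>

lemma mult_op_comp_op_in_disk_analytic:
  assumes "\<psi> \<in> disk_analytic" "\<phi> \<in> disk_analytic"
  shows "(mult_op \<psi> \<circ> comp_op \<phi>) p \<in> disk_analytic"
proof -
  have "(\<lambda>z. \<psi> z * poly p (\<phi> z)) holomorphic_on unit_disk"
    using assms by (auto simp: disk_analytic_def analytic_on_open intro!: holomorphic_intros)
  then show ?thesis
    using assms by (auto simp: disk_analytic_def mult_op_def comp_op_def o_def analytic_on_open)
qed

end

theory Submission
  imports Defs "HOL-Computational_Algebra.Fundamental_Theorem_Algebra"
begin

text \<open>
  If \<open>A\<close> kills a polynomial \<open>p\<close> without zeros on the closed disk, then every \<open>A q\<close> is a multiple
  of \<open>A (p + \<epsilon> q)\<close> with \<open>p + \<epsilon> q\<close> stable for small \<open>\<epsilon>\<close>; hence no nonzero function in the range of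
  \<open>A\<close> vanishes anywhere on \<open>\<Omega>\<close>, which forces rank at most one. Otherwise, for each
  \<open>z \<in> \<Omega>\<close> the functional \<open>p \<mapsto> A p z\<close> is nonzero on polynomials without zeros on the closed disk,
  and an argument in the style of Gleason, Kahane and Zelazko shows that it is a multiple of
  evaluation at a point \<open>\<phi> z\<close> of the closed disk. The open mapping theorem
  puts \<open>\<phi> z\<close> into the open disk unless \<open>\<phi>\<close> is constant, and \<open>\<phi>\<close> extends to the whole disk
  because all the products \<open>A 1 * \<phi> ^ n\<close> do.
\<close>

section \<open>Functionals that do not vanish on zero-free polynomials\<close>

text \<open>In terms of the reciprocals \<open>\<beta>\<close> of the roots of \<open>P\<close>, the quantity bounded here is the sum
  of the \<open>\<beta>\<^sup>2\<close>.\<close>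

lemma second_power_sum_bound:
  fixes P :: "complex poly"
  assumes "coeff P 0 = 1" "degree P \<le> n" "\<And>c. poly P c = 0 \<Longrightarrow> 1 \<le> R * norm c"
  shows "norm ((coeff P 1)\<^sup>2 - 2 * coeff P 2) \<le> real n * R\<^sup>2"
  using assms
proof (induction n arbitrary: P)
  case 0
  then have "coeff P 1 = 0" "coeff P 2 = 0"
    by (auto intro: coeff_eq_0)
  then show ?case by simp
next
  case (Suc n)
  show ?case
  proof (cases "degree P = 0")
    case True
    then have "coeff P 1 = 0" "coeff P 2 = 0"
      by (auto intro: coeff_eq_0)
    then show ?thesis by simp
  next
    case False
    then have "\<not> constant (poly P)"
      by (simp add: constant_degree)
    then obtain a where a: "poly P a = 0"
      using fundamental_theorem_of_algebra by blast
    have a0: "a \<noteq> 0"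
      using a Suc.prems(1) by (auto simp: poly_0_coeff_0)
    obtain S where S: "P = [:- a, 1:] * S"
      using a poly_eq_0_iff_dvd by (metis dvdE)
    \<comment> \<open>Rescaling by \<open>- a\<close> keeps the constant coefficient equal to 1, so
      the linear factor becomes \<open>1 - b * X\<close> with \<open>b\<close> the reciprocal root.
      Splitting it off changes the power sum by exactly \<open>b\<^sup>2\<close>.\<close>
    define T where "T = smult (- a) S"
    define b where "b = inverse a"
    have P: "P = [:1, - b:] * T"
      using a0 by (simp add: S T_def b_def smult_add_right)
    have "P \<noteq> 0" using False by auto
    then have "T \<noteq> 0" using P by auto
    have "degree P = Suc (degree T)"
      unfolding P using \<open>T \<noteq> 0\<close> a0 by (subst degree_mult_eq) (auto simp: b_def)
    moreover have T0: "coeff T 0 = 1"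
      using Suc.prems(1) by (simp add: P)
    ultimately have IH: "norm ((coeff T 1)\<^sup>2 - 2 * coeff T 2) \<le> real n * R\<^sup>2"
      using Suc.prems by (intro Suc.IH) (auto simp: P)
    have c1: "coeff P 1 = coeff T 1 - b"
      by (simp add: P T0)
    have c2: "coeff P 2 = coeff T 2 - b * coeff T 1"
      by (simp add: P numeral_2_eq_2)
    have eq: "(coeff P 1)\<^sup>2 - 2 * coeff P 2 = ((coeff T 1)\<^sup>2 - 2 * coeff T 2) + b\<^sup>2"
      unfolding c1 c2 by (simp add: power2_eq_square algebra_simps)
    have "norm b = inverse (norm a)"
      by (simp add: b_def norm_inverse)
    then have "norm b \<le> R"
      using Suc.prems(3)[OF a] a0 by (simp add: inverse_eq_divide pos_divide_le_eq)
    then have "norm (b\<^sup>2) \<le> R\<^sup>2"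
      by (simp add: norm_power power_mono)
    then show ?thesis
      unfolding eq using IH norm_triangle_ineq[of "(coeff T 1)\<^sup>2 - 2 * coeff T 2" "b\<^sup>2"]
      by (simp add: algebra_simps)
  qed
qed

lemma poly_bounded_on_cball:
  fixes p :: "complex poly"
  obtains R where "R > 0" "\<And>z. z \<in> cball 0 1 \<Longrightarrow> norm (poly p z) \<le> R"
proof -
  have "compact (poly p ` cball 0 1)"
    by (intro compact_continuous_image continuous_intros) auto
  then show ?thesis
    using that by (metis bounded_pos compact_imp_bounded imageI)
qed

text \<open>The instances are \<open>p \<mapsto> A p z / A 1 z\<close> for \<open>z\<close> in
  \<open>\<Omega>\<close>.\<close>

locale zero_free_functional =
  fixes m :: "complex poly \<Rightarrow> complex"
  assumes add: "m (p + q) = m p + m q"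
    and scale: "m (smult c p) = c * m p"
    and one: "m 1 = 1"
    and nonzero: "(\<And>z. z \<in> cball 0 1 \<Longrightarrow> poly p z \<noteq> 0) \<Longrightarrow> m p \<noteq> 0"
begin

lemma zero: "m 0 = 0"
  using scale[of 0 0] by simp

lemma sum: "m (\<Sum>i\<in>I. f i) = (\<Sum>i\<in>I. m (f i))"
  by (induction I rule: infinite_finite_induct) (auto simp: zero add)

text \<open>Regard \<open>m ((1 - smult c p) ^ n)\<close> as a polynomial in \<open>c\<close>. If
  \<open>R\<close> bounds \<open>p\<close> on the closed disk, its roots have modulus at least
  \<open>1 / R\<close>. The sum of the squares of the reciprocal roots, at most
  \<open>n * R\<^sup>2\<close> in modulus, equals \<open>n\<^sup>2 * d + n * m (p\<^sup>2)\<close>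
  with \<open>d = (m p)\<^sup>2 - m (p\<^sup>2)\<close>; letting \<open>n\<close> grow forces
  \<open>d = 0\<close>.\<close>

lemma power2: "m (p\<^sup>2) = (m p)\<^sup>2"
proof -
  obtain R where R: "R > 0" "\<And>z. z \<in> cball 0 1 \<Longrightarrow> norm (poly p z) \<le> R"
    using poly_bounded_on_cball[of p] by metis
  have bound: "norm ((of_nat n * m p)\<^sup>2 - of_nat n * (of_nat n - 1) * m (p\<^sup>2)) \<le> real n * R\<^sup>2"
    for n
  proof -
    define Q where "Q = (\<Sum>k\<le>n. monom (of_nat (n choose k) * (-1) ^ k * m (p ^ k)) k)"
    have coeff: "coeff Q k = of_nat (n choose k) * (-1) ^ k * m (p ^ k)" for k
      by (simp add: Q_def coeff_sum sum.delta binomial_eq_0)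
    have eval: "poly Q c = m ((1 - smult c p) ^ n)" for c
    proof -
      have "(1 - smult c p) ^ n = (smult (- c) p + 1) ^ n"
        by simp
      also have "\<dots> = (\<Sum>k\<le>n. smult (of_nat (n choose k) * (- c) ^ k) (p ^ k))"
        unfolding binomial_ring
        by (intro sum.cong) (simp_all add: of_nat_poly smult_power mult.commute del: smult_minus_left)
      finally show ?thesis
        by (simp add: sum scale Q_def poly_sum poly_monom power_minus[of c] algebra_simps)
    qed
    have "1 \<le> R * norm c" if "poly Q c = 0" for c
    proof (rule ccontr)
      assume "\<not> 1 \<le> R * norm c"
      have "poly ((1 - smult c p) ^ n) z \<noteq> 0" if z: "z \<in> cball 0 1" for z
      proof -
        have "norm (c * poly p z) \<le> R * norm c"
          using R(2)[OF z] by (simp add: norm_mult mult_left_mono mult.commute[of R])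
        then have "norm (c * poly p z) < 1"
          using \<open>\<not> 1 \<le> R * norm c\<close> by simp
        then have "c * poly p z \<noteq> 1"
          by auto
        then show ?thesis by simp
      qed
      then show False
        using nonzero eval that by metis
    qed
    moreover have "degree Q \<le> n"
      unfolding Q_def by (intro degree_sum_le) (auto intro: order.trans[OF degree_monom_le])
    ultimately have "norm ((coeff Q 1)\<^sup>2 - 2 * coeff Q 2) \<le> real n * R\<^sup>2"
      by (intro second_power_sum_bound) (auto simp: coeff one)
    moreover have "2 * of_nat (n choose 2) = (of_nat n * (of_nat n - 1) :: complex)"
    proof -
      have "2 * (n choose 2) = n * (n - 1)"
        by (cases n) (auto simp: choose_two)
      then have "of_nat (2 * (n choose 2)) = (of_nat (n * (n - 1)) :: complex)"
        by simp
      then show ?thesis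
        by (cases n) (auto simp: algebra_simps)
    qed
    ultimately show ?thesis
      by (simp add: coeff power_mult_distrib flip: mult.assoc)
  qed
  define d where "d = (m p)\<^sup>2 - m (p\<^sup>2)"
  have "real n * norm d \<le> R\<^sup>2 + norm (m (p\<^sup>2))" if "n > 0" for n
  proof -
    have "(of_nat n * m p)\<^sup>2 - of_nat n * (of_nat n - 1) * m (p\<^sup>2)
        = of_nat n * (of_nat n * d + m (p\<^sup>2))"
      by (simp add: d_def power2_eq_square algebra_simps)
    then have "real n * norm (of_nat n * d + m (p\<^sup>2)) \<le> real n * R\<^sup>2"
      using bound[of n] by (simp add: norm_mult)
    then have "norm (of_nat n * d + m (p\<^sup>2)) \<le> R\<^sup>2"
      using that by simp
    then show ?thesis
      using norm_diff_ineq[of "of_nat n * d" "m (p\<^sup>2)"] by (simp add: norm_mult)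
  qed
  \<comment> \<open>A positive \<open>norm d\<close> would have a multiple above the bound. The
    multiplier cannot be 0 because the bound is nonnegative.\<close>
  then have "\<not> norm d > 0"
    using reals_Archimedean3[of "norm d"]
    by (metis less_le_not_le linorder_not_le mult_eq_0_iff of_nat_0 not_gr_zero norm_ge_zero
        add_nonneg_nonneg zero_le_power2)
  then show ?thesis
    by (simp add: d_def)
qed

text \<open>Polarization: apply \<open>power2\<close> to \<open>p + q\<close>.\<close>

lemma mult: "m (p * q) = m p * m q"
proof -
  have "(p + q)\<^sup>2 = p\<^sup>2 + q\<^sup>2 + smult 2 (p * q)"
    using smult_add_left[of 1 1 "p * q"] by (simp add: power2_eq_square algebra_simps)
  then have "(m p + m q)\<^sup>2 = (m p)\<^sup>2 + (m q)\<^sup>2 + 2 * m (p * q)"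
    using power2[of "p + q"] by (simp add: add scale power2)
  then show ?thesis
    by (simp add: power2_eq_square algebra_simps)
qed

text \<open>Being linear, multiplicative and unital, \<open>m\<close> is an algebra homomorphism,
  hence determined by the image of the variable.\<close>

lemma eq_poly: "m p = poly p (m [:0, 1:])"
proof (induction p)
  case 0
  then show ?case by (simp add: zero)
next
  case (pCons a p)
  have "pCons a p = smult a 1 + [:0, 1:] * p"
    by simp
  then have "m (pCons a p) = a + m [:0, 1:] * m p"
    by (metis add scale mult one mult.right_neutral)
  with pCons show ?case by simp
qed

text \<open>The polynomial \<open>X - m X\<close> lies in the kernel of \<open>m\<close>, so its
  only root \<open>m X\<close> must lie in the closed disk.\<close>

lemma norm_le_1: "norm (m [:0, 1:]) \<le> 1"
proof (rule ccontr)
  let ?p = "[:- m [:0, 1:], 1:]"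
  assume *: "\<not> norm (m [:0, 1:]) \<le> 1"
  have "m ?p \<noteq> 0"
    by (rule nonzero) (use * in auto)
  then show False
    by (simp add: eq_poly[of ?p])
qed

end

section \<open>Division of holomorphic functions\<close>

text \<open>Here \<open>k\<close> is the order of vanishing of \<open>f\<close> at \<open>z\<close>,
  possibly 0, and the ball is small enough to contain no other zero.\<close>

lemma holomorphic_factor_out:
  assumes "f holomorphic_on S" "open S" "connected S" "z \<in> S" "\<exists>w\<in>S. f w \<noteq> 0"
  obtains k u r where "r > 0" "ball z r \<subseteq> S" "u holomorphic_on ball z r"
    "\<And>w. w \<in> ball z r \<Longrightarrow> f w = (w - z) ^ k * u w" "\<And>w. w \<in> ball z r \<Longrightarrow> u w \<noteq> 0"
proof -
  obtain r where "r > 0" "cball z r \<subseteq> S" "zor_poly f z holomorphic_on cball z r"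
    and "\<forall>w\<in>cball z r. f w = zor_poly f z w * (w - z) ^ nat (zorder f z) \<and> zor_poly f z w \<noteq> 0"
    using zorder_exist_zero[OF assms] by auto
  then show ?thesis
    by (intro that[of r "zor_poly f z" "nat (zorder f z)"])
      (auto intro: holomorphic_on_subset simp: mult.commute)
qed

text \<open>The hypothesis says that \<open>f * (g / f) ^ n\<close> is holomorphic for every \<open>n > 0\<close>. A pole of
  \<open>g / f\<close> would contradict this for \<open>n\<close> larger than the order of the zero of \<open>f\<close> there.\<close>

lemma holomorphic_quotient_of_powers:
  assumes f: "f holomorphic_on S" and g: "g holomorphic_on S" and h: "\<And>n. h n holomorphic_on S"
    and S: "open S" "connected S" and nz: "\<exists>w\<in>S. f w \<noteq> 0"
    and eq: "\<And>n z. z \<in> S \<Longrightarrow> g z ^ Suc n = f z ^ n * h n z"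
  obtains \<phi> where "\<phi> holomorphic_on S" "\<And>z. z \<in> S \<Longrightarrow> g z = \<phi> z * f z"
proof (cases "\<exists>w\<in>S. g w \<noteq> 0")
  case False
  then show ?thesis
    by (intro that[of "\<lambda>_. 0"]) auto
next
  case True
  have quotient_near: "\<exists>r>0. \<exists>\<theta>. ball z r \<subseteq> S \<and> \<theta> holomorphic_on ball z r \<and>
      (\<forall>w\<in>ball z r. g w = \<theta> w * f w \<and> (w \<noteq> z \<longrightarrow> f w \<noteq> 0))" if z: "z \<in> S" for z
  proof -
    obtain k u r where u: "r > 0" "ball z r \<subseteq> S" "u holomorphic_on ball z r"
      "\<And>w. w \<in> ball z r \<Longrightarrow> f w = (w - z) ^ k * u w" "\<And>w. w \<in> ball z r \<Longrightarrow> u w \<noteq> 0"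
      using holomorphic_factor_out[OF f S z nz] by metis
    obtain l v s where v: "s > 0" "ball z s \<subseteq> S" "v holomorphic_on ball z s"
      "\<And>w. w \<in> ball z s \<Longrightarrow> g w = (w - z) ^ l * v w" "\<And>w. w \<in> ball z s \<Longrightarrow> v w \<noteq> 0"
      using holomorphic_factor_out[OF g S z True] by metis
    define t where "t = min r s"
    have t: "t > 0" "ball z t \<subseteq> ball z r" "ball z t \<subseteq> ball z s"
      using u v by (auto simp: t_def)
    have "k \<le> l"
    proof (rule ccontr)
      assume "\<not> k \<le> l"
      then obtain j where j: "k = Suc (l + j)"
        using less_imp_Suc_add linorder_not_le by blast
      \<comment> \<open>Take the hypothesis with exponent \<open>n = k\<close>. The left side
        vanishes at \<open>z\<close> to order \<open>l * Suc k\<close>, the right side to order at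
        least \<open>k * k\<close>; \<open>e\<close> is the positive surplus. Cancelling the common
        power off \<open>z\<close> and passing to the limit gives
        \<open>v z ^ Suc k = 0\<close>.\<close>
      define e where "e = Suc (k * j + j)"
      have e: "k * k = l * Suc k + e"
        by (simp add: e_def j algebra_simps)
      define F where "F = (\<lambda>w. (w - z) ^ e * (u w ^ k * h k w))"
      have "v w ^ Suc k = F w" if w: "w \<in> ball z t - {z}" for w
      proof -
        have w': "w \<in> ball z r" "w \<in> ball z s" "w \<in> S"
          using w t u(2) by auto
        have "(w - z) ^ (l * Suc k) * v w ^ Suc k = (w - z) ^ (k * k) * (u w ^ k * h k w)"
          using eq[OF w'(3), of k] unfolding u(4)[OF w'(1)] v(4)[OF w'(2)]
          by (simp only: power_mult_distrib power_mult mult.assoc)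
        also have "\<dots> = (w - z) ^ (l * Suc k) * F w"
          by (simp only: e power_add F_def mult.assoc)
        finally show ?thesis
          using w by simp
      qed
      then have "\<forall>\<^sub>F w in at z. v w ^ Suc k = F w"
        using t(1) eventually_at_in_open[of "ball z t" z] by (auto elim: eventually_mono)
      moreover have "(v \<longlongrightarrow> v z) (at z)"
        using v(1,3) by (metis centre_in_ball continuous_on_interior holomorphic_on_imp_continuous_on
            interior_ball isCont_def)
      then have "((\<lambda>w. v w ^ Suc k) \<longlongrightarrow> v z ^ Suc k) (at z)"
        by (rule tendsto_power)
      ultimately have lim1: "(F \<longlongrightarrow> v z ^ Suc k) (at z)"
        by (rule Lim_transform_eventually[rotated])
      have "F holomorphic_on ball z r"
        unfolding F_def by (intro holomorphic_intros u holomorphic_on_subset[OF h u(2)])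
      then have "(F \<longlongrightarrow> F z) (at z)"
        using u(1) by (metis centre_in_ball continuous_on_interior holomorphic_on_imp_continuous_on
            interior_ball isCont_def)
      then have "v z ^ Suc k = F z"
        using lim1 by (metis LIM_unique)
      moreover have "F z = 0"
        by (simp add: F_def e_def)
      moreover have "v z \<noteq> 0"
        using v(1,5) by simp
      ultimately show False
        by simp
    qed
    then obtain j where j: "l = k + j"
      using le_Suc_ex by blast
    define \<theta> where "\<theta> = (\<lambda>w. (w - z) ^ j * v w / u w)"
    have "\<theta> holomorphic_on ball z t"
      unfolding \<theta>_def using t u(5)
      by (intro holomorphic_intros holomorphic_on_subset[OF u(3)] holomorphic_on_subset[OF v(3)]) auto
    moreover have "g w = \<theta> w * f w \<and> (w \<noteq> z \<longrightarrow> f w \<noteq> 0)" if "w \<in> ball z t" for w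
    proof -
      have w': "w \<in> ball z r" "w \<in> ball z s"
        using that t by auto
      show ?thesis
        using u(5)[OF w'(1)] unfolding u(4)[OF w'(1)] v(4)[OF w'(2)]
        by (simp add: \<theta>_def j power_add)
    qed
    ultimately show ?thesis
      using t u(2) by (intro exI[of _ t] conjI exI[of _ \<theta>]) auto
  qed
  \<comment> \<open>Defining the quotient by its limits makes the local quotients
    \<open>\<theta>\<close> glue without any choice: each agrees with \<open>g / f\<close> off the
    centre of its ball, where \<open>f\<close> has no zero.\<close>
  define \<phi> where "\<phi> = remove_sings (\<lambda>w. g w / f w)"
  have agree: "\<phi> w = \<theta> w"
    if "\<theta> holomorphic_on ball z r" "\<forall>w\<in>ball z r. g w = \<theta> w * f w \<and> (w \<noteq> z \<longrightarrow> f w \<noteq> 0)"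
      "w \<in> ball z r" for z r \<theta> w
  proof -
    have "(\<theta> \<longlongrightarrow> \<theta> w) (at w)"
      using that by (metis continuous_on_interior holomorphic_on_imp_continuous_on
          interior_ball isCont_def)
    moreover have "\<forall>\<^sub>F x in at w. x \<in> ball z r \<and> x \<noteq> z"
      using that(3) by (intro eventually_conj eventually_at_in_open' eventually_neq_at_within) auto
    then have "\<forall>\<^sub>F x in at w. \<theta> x = g x / f x"
      by eventually_elim (use that in auto)
    ultimately have "((\<lambda>w. g w / f w) \<longlongrightarrow> \<theta> w) (at w)"
      by (rule Lim_transform_eventually)
    then show ?thesis
      unfolding \<phi>_def by (rule remove_sings_eqI)
  qed
  have "\<phi> analytic_on {z} \<and> g z = \<phi> z * f z" if z: "z \<in> S" for z
  proof -
    obtain r \<theta> where r: "r > 0" "\<theta> holomorphic_on ball z r"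
      "\<forall>w\<in>ball z r. g w = \<theta> w * f w \<and> (w \<noteq> z \<longrightarrow> f w \<noteq> 0)"
      using quotient_near[OF z] by blast
    have "\<phi> holomorphic_on ball z r"
      using r(2) by (rule holomorphic_transform) (use agree[OF r(2,3)] in auto)
    then show ?thesis
      using r agree[OF r(2,3), of z] by (auto simp: analytic_at intro: exI[of _ "ball z r"])
  qed
  then show ?thesis
    using that[of \<phi>] by (metis S(1) analytic_on_analytic_at analytic_on_open)
qed

section \<open>Stability preservers\<close>

text \<open>By compactness \<open>norm (poly p z)\<close> has a positive minimum on the closed disk.
  The chosen \<open>e\<close> keeps the perturbation at or below half of it.\<close>

lemma stable_perturbation:
  fixes p q :: "complex poly"
  assumes "\<And>z. z \<in> cball 0 1 \<Longrightarrow> poly p z \<noteq> 0"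
  obtains e where "e \<noteq> 0" "p + smult e q \<in> stable_polys"
proof -
  obtain R where R: "R > 0" "\<And>z. z \<in> cball 0 1 \<Longrightarrow> norm (poly q z) \<le> R"
    using poly_bounded_on_cball[of q] by metis
  have "continuous_on (cball 0 1) (\<lambda>z. norm (poly p z))"
    by (intro continuous_intros)
  then obtain x where x: "x \<in> cball 0 1" "\<And>z. z \<in> cball 0 1 \<Longrightarrow> norm (poly p x) \<le> norm (poly p z)"
    using continuous_attains_inf[of "cball 0 1" "\<lambda>z. norm (poly p z)"] by auto
  define e where "e = norm (poly p x) / (2 * R)"
  have "norm (poly p x) > 0"
    using assms x by simp
  then have e: "e > 0"
    using R by (simp add: e_def)
  have "poly (p + smult (of_real e) q) z \<noteq> 0" if "z \<in> ball 0 1" for z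
  proof
    have z: "z \<in> cball 0 1" using that by auto
    assume "poly (p + smult (of_real e) q) z = 0"
    then have "poly p z = - (of_real e * poly q z)"
      by (simp add: eq_neg_iff_add_eq_0)
    then have "norm (poly p z) = e * norm (poly q z)"
      using e by (simp add: norm_mult)
    also have "\<dots> \<le> e * R"
      using R(2)[OF z] e by simp
    also have "\<dots> < norm (poly p x)"
      using R \<open>norm (poly p x) > 0\<close> by (simp add: e_def)
    finally show False
      using x(2)[OF z] by simp
  qed
  then show ?thesis
    using e by (intro that[of "of_real e"]) (auto simp: stable_polys_def)
qed

text \<open>The identity theorem gives equality on the disk; outside it both functions are 0 by the
  encoding.\<close>

lemma disk_analytic_eqI:
  assumes "f \<in> disk_analytic" "g \<in> disk_analytic" "\<Omega> \<subseteq> unit_disk" "\<Omega> \<noteq> {}" "open \<Omega>"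
    and "\<And>z. z \<in> \<Omega> \<Longrightarrow> f z = g z"
  shows "f = g"
proof
  fix z
  show "f z = g z"
  proof (cases "z \<in> unit_disk")
    case True
    show ?thesis
      by (rule analytic_continuation_open[of \<Omega> unit_disk f g])
        (use assms True in \<open>auto simp: disk_analytic_def analytic_on_open\<close>)
  next
    case False
    then show ?thesis
      using assms by (simp add: disk_analytic_def)
  qed
qed

section \<open>Sufficiency of the two forms\<close>

lemma rank_one_preserves_stability:
  assumes "\<psi> \<in> stable_analytic \<Omega>" "\<And>f. A f = fun_scale (\<nu> f) \<psi>" "range A \<subseteq> disk_analytic"
  shows "A ` stable_polys \<subseteq> stable_analytic \<Omega>"
  using assms by (fastforce simp: stable_analytic_def fun_scale_def)

lemma weighted_composition_preserves_stability:
  assumes "\<psi> \<in> stable_analytic \<Omega>" "\<phi> \<in> disk_analytic" "\<phi> ` \<Omega> \<subseteq> unit_disk"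
  shows "(mult_op \<psi> \<circ> comp_op \<phi>) ` stable_polys \<subseteq> stable_analytic \<Omega>"
proof
  fix g
  assume "g \<in> (mult_op \<psi> \<circ> comp_op \<phi>) ` stable_polys"
  then obtain p where p: "p \<in> stable_polys" and g: "g = (mult_op \<psi> \<circ> comp_op \<phi>) p"
    by auto
  show "g \<in> stable_analytic \<Omega>"
  proof (cases "\<psi> = 0 \<or> p = 0")
    case True
    then have "g = 0"
      by (auto simp: g mult_op_def comp_op_def fun_eq_iff)
    then show ?thesis
      by (simp add: stable_analytic_def)
  next
    case False
    then have "\<psi> \<in> disk_analytic" "\<And>z. z \<in> \<Omega> \<Longrightarrow> \<psi> z \<noteq> 0"
      "\<And>z. z \<in> unit_disk \<Longrightarrow> poly p z \<noteq> 0"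
      using assms(1) p by (auto simp: stable_analytic_def stable_polys_def)
    moreover from this have "g \<in> disk_analytic"
      unfolding g by (intro mult_op_comp_op_in_disk_analytic assms(2))
    ultimately show ?thesis
      using assms(3) by (auto simp: stable_analytic_def g mult_op_def comp_op_def image_subset_iff)
  qed
qed

section \<open>Necessity: the structure of a stability preserver\<close>

locale stability_preserver =
  fixes \<Omega> :: "complex set" and A :: "complex poly \<Rightarrow> complex \<Rightarrow> complex"
  assumes sub: "\<Omega> \<subseteq> unit_disk" and ne: "\<Omega> \<noteq> {}" and opn: "open \<Omega>"
    and range: "range A \<subseteq> disk_analytic"
    and add: "A (p + q) z = A p z + A q z" and scale: "A (smult c p) z = c * A p z"
    and preserves: "A ` stable_polys \<subseteq> stable_analytic \<Omega>"
begin

lemma nonzero_at: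
  assumes "p \<in> stable_polys" "A p \<noteq> 0" "z \<in> \<Omega>"
  shows "A p z \<noteq> 0"
  using preserves assms by (auto simp: stable_analytic_def)

lemma rank_one_if_kills:
  assumes p: "\<And>z. z \<in> cball 0 1 \<Longrightarrow> poly p z \<noteq> 0" and "A p = 0"
  shows "\<exists>\<psi>\<in>stable_analytic \<Omega>. \<exists>\<nu>. Vector_Spaces.linear smult (*) \<nu> \<and> (\<forall>f. A f = fun_scale (\<nu> f) \<psi>)"
proof -
  have nz: "A q z \<noteq> 0" if "A q \<noteq> 0" "z \<in> \<Omega>" for q z
  proof -
    obtain e where e: "e \<noteq> 0" "p + smult e q \<in> stable_polys"
      using stable_perturbation[OF p] by metis
    have eq: "A (p + smult e q) w = e * A q w" for w
      by (simp add: add scale \<open>A p = 0\<close>)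
    have "A (p + smult e q) \<noteq> 0"
    proof
      assume "A (p + smult e q) = 0"
      then have "A q w = 0" for w
        using eq[of w] e by simp
      then show False using that(1) by (auto simp: fun_eq_iff)
    qed
    from nonzero_at[OF e(2) this that(2)] show ?thesis
      by (simp add: eq)
  qed
  have vs: "Vector_Spaces.linear smult (*) \<nu>"
    if "\<And>p q. \<nu> (p + q) = \<nu> p + \<nu> q" "\<And>c p. \<nu> (smult c p) = c * \<nu> p"
    for \<nu> :: "complex poly \<Rightarrow> complex"
    using that vector_space_smult
    by (auto simp: Vector_Spaces.linear_iff vector_space_def algebra_simps)
  show ?thesis
  proof (cases "\<exists>q. A q \<noteq> 0")
    case False
    \<comment> \<open>The zero map has the rank-one form with \<open>\<psi> = 0\<close>, which
      \<open>stable_analytic\<close> contains.\<close>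
    then show ?thesis
      by (intro bexI[of _ 0] exI[of _ "\<lambda>_. 0"] conjI vs)
        (auto simp: stable_analytic_def fun_scale_def fun_eq_iff)
  next
    case True
    then obtain q where q: "A q \<noteq> 0" by blast
    obtain z where z: "z \<in> \<Omega>" using ne by blast
    have qz: "A q z \<noteq> 0" using nz q z by blast
    \<comment> \<open>This coefficient makes \<open>A (f - \<nu> f * q)\<close> vanish at
      \<open>z\<close>; by \<open>nz\<close> it then vanishes identically.\<close>
    define \<nu> where "\<nu> = (\<lambda>f. A f z / A q z)"
    have "A f = fun_scale (\<nu> f) (A q)" for f
    proof -
      have eq: "A (f + smult (- \<nu> f) q) w = A f w - \<nu> f * A q w" for w
        by (simp only: add scale) simp
      have "A (f + smult (- \<nu> f) q) z = 0"
        using qz by (simp only: eq) (simp add: \<nu>_def)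
      then have "A (f + smult (- \<nu> f) q) = 0"
        using nz z by blast
      then have "A f w - \<nu> f * A q w = 0" for w
        using eq[of w] by simp
      then show ?thesis
        by (auto simp: fun_scale_def fun_eq_iff)
    qed
    moreover have "A q \<in> stable_analytic \<Omega>"
      using range nz[OF q] by (auto simp: stable_analytic_def)
    moreover have "Vector_Spaces.linear smult (*) \<nu>"
      by (rule vs) (auto simp: \<nu>_def add scale add_divide_distrib)
    ultimately show ?thesis by blast
  qed
qed

lemma holomorphic: "A p holomorphic_on unit_disk"
  using range by (auto simp: disk_analytic_def analytic_on_open)

lemma weighted_composition:
  assumes kill: "\<And>p. (\<And>z. z \<in> cball 0 1 \<Longrightarrow> poly p z \<noteq> 0) \<Longrightarrow> A p \<noteq> 0"
  obtains \<phi> where "\<phi> \<in> disk_analytic" "A = mult_op (A 1) \<circ> comp_op \<phi>"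
    "\<phi> ` \<Omega> \<subseteq> cball 0 1" "A 1 \<in> stable_analytic \<Omega>"
proof -
  have nz: "A p z \<noteq> 0" if "z \<in> \<Omega>" "\<And>z. z \<in> cball 0 1 \<Longrightarrow> poly p z \<noteq> 0" for p z
    by (rule nonzero_at) (use that kill in \<open>auto simp: stable_polys_def\<close>)
  have nz1: "A 1 z \<noteq> 0" if "z \<in> \<Omega>" for z
    by (rule nz) (use that in auto)
  \<comment> \<open>The polynomials 1 and \<open>X\<close> force this formula for the symbol on
    \<open>\<Omega>\<close>, where \<open>A 1\<close> has no zero.\<close>
  define \<phi>0 where "\<phi>0 = (\<lambda>z. A [:0, 1:] z / A 1 z)"
  have gkz: "A p z = A 1 z * poly p (\<phi>0 z)" "norm (\<phi>0 z) \<le> 1" if z: "z \<in> \<Omega>" for p z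
  proof -
    interpret zero_free_functional "\<lambda>p. A p z / A 1 z"
      using nz1[OF z] nz[OF z] by unfold_locales (auto simp: add scale add_divide_distrib)
    show "A p z = A 1 z * poly p (\<phi>0 z)"
      using eq_poly[of p] nz1[OF z] by (simp add: \<phi>0_def field_simps)
    show "norm (\<phi>0 z) \<le> 1"
      using norm_le_1 by (simp add: \<phi>0_def)
  qed
  \<comment> \<open>On \<open>\<Omega>\<close> both sides equal
    \<open>(A 1 z * \<phi>0 z) ^ Suc n\<close>, and analytic continuation carries the identity to
    the disk. It makes the quotient of \<open>A X\<close> by \<open>A 1\<close> holomorphic even at
    zeros of \<open>A 1\<close> outside \<open>\<Omega>\<close>.\<close>
  have pow: "A [:0, 1:] z ^ Suc n = A 1 z ^ n * A ([:0, 1:] ^ Suc n) z" if "z \<in> unit_disk" for n z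
  proof (rule analytic_continuation_open[of \<Omega> unit_disk "\<lambda>z. A [:0, 1:] z ^ Suc n"
        "\<lambda>z. A 1 z ^ n * A ([:0, 1:] ^ Suc n) z"])
    show "A [:0, 1:] w ^ Suc n = A 1 w ^ n * A ([:0, 1:] ^ Suc n) w" if "w \<in> \<Omega>" for w
      using gkz(1)[OF that, of "[:0, 1:]"] gkz(1)[OF that, of "[:0, 1:] ^ Suc n"]
      by (simp add: power_mult_distrib)
  qed (use sub ne opn that in \<open>auto intro!: holomorphic_intros holomorphic\<close>)
  have "\<exists>w\<in>unit_disk. A 1 w \<noteq> 0"
    using ne sub nz1 by blast
  then obtain \<phi> where \<phi>: "\<phi> holomorphic_on unit_disk"
    "\<And>z. z \<in> unit_disk \<Longrightarrow> A [:0, 1:] z = \<phi> z * A 1 z"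
    using holomorphic_quotient_of_powers[OF holomorphic holomorphic holomorphic open_ball
        connected_ball _ pow] by metis
  \<comment> \<open>Values outside the disk are reset to 0 to obtain a member of
    \<open>disk_analytic\<close>.\<close>
  define \<theta> where "\<theta> = (\<lambda>z. if z \<in> unit_disk then \<phi> z else 0)"
  have "\<theta> holomorphic_on unit_disk"
    using \<phi>(1) by (rule holomorphic_transform) (simp add: \<theta>_def)
  then have \<theta>: "\<theta> \<in> disk_analytic"
    by (auto simp: disk_analytic_def analytic_on_open \<theta>_def)
  have \<theta>_eq: "\<theta> z = \<phi>0 z" if "z \<in> \<Omega>" for z
    using \<phi>(2)[of z] nz1[OF that] that sub by (auto simp: \<theta>_def \<phi>0_def)
  have A1: "A 1 \<in> stable_analytic \<Omega>"
    using range nz1 by (auto simp: stable_analytic_def)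
  have A1': "A 1 \<in> disk_analytic"
    using range by auto
  have "A p = (mult_op (A 1) \<circ> comp_op \<theta>) p" for p
  proof (rule disk_analytic_eqI[OF _ _ sub ne opn])
    show "A p z = (mult_op (A 1) \<circ> comp_op \<theta>) p z" if "z \<in> \<Omega>" for z
      using gkz(1)[OF that, of p] by (simp add: mult_op_def comp_op_def \<theta>_eq[OF that])
  qed (use range mult_op_comp_op_in_disk_analytic[OF A1' \<theta>] in auto)
  then have "A = mult_op (A 1) \<circ> comp_op \<theta>"
    by (rule ext)
  moreover have "\<theta> ` \<Omega> \<subseteq> cball 0 1"
    using \<theta>_eq gkz(2) by auto
  ultimately show ?thesis
    using that[OF \<theta> _ _ A1] by blast
qed

end

theorem theorem1:
  fixes \<Omega> :: "complex set" and A :: "complex poly \<Rightarrow> complex \<Rightarrow> complex"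
  assumes "\<Omega> \<subseteq> unit_disk" and "\<Omega> \<noteq> {}" and "connected \<Omega>" and "open \<Omega>"
    and "range A \<subseteq> disk_analytic" and "Vector_Spaces.linear smult fun_scale A"
  shows "A ` stable_polys \<subseteq> stable_analytic \<Omega> \<longleftrightarrow>
    (\<exists>\<psi>\<in>stable_analytic \<Omega>. \<exists>\<nu> :: complex poly \<Rightarrow> complex.
        Vector_Spaces.linear smult (*) \<nu> \<and> (\<forall>f. A f = fun_scale (\<nu> f) \<psi>)) \<or>
    (\<exists>\<psi>\<in>stable_analytic \<Omega>. \<exists>\<phi>\<in>disk_analytic.
        \<not> \<phi> constant_on unit_disk \<and> \<phi> ` \<Omega> \<subseteq> unit_disk \<and> A = mult_op \<psi> \<circ> comp_op \<phi>)"
    (is "?L \<longleftrightarrow> ?R1 \<or> ?R2")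
proof
  assume "?R1 \<or> ?R2"
  then show ?L
    using rank_one_preserves_stability[OF _ _ assms(5)] weighted_composition_preserves_stability
    by metis
next
  assume L: ?L
  interpret stability_preserver \<Omega> A
    using assms L by unfold_locales (auto simp: Vector_Spaces.linear_iff fun_scale_def)
  show "?R1 \<or> ?R2"
  proof (cases "\<exists>p. (\<forall>z\<in>cball 0 1. poly p z \<noteq> 0) \<and> A p = 0")
    case True
    then show ?thesis
      using rank_one_if_kills by blast
  next
    case False
    then obtain \<phi> where \<phi>: "\<phi> \<in> disk_analytic" "A = mult_op (A 1) \<circ> comp_op \<phi>"
      "\<phi> ` \<Omega> \<subseteq> cball 0 1" "A 1 \<in> stable_analytic \<Omega>"
      using weighted_composition by metis
    have hol: "\<phi> holomorphic_on unit_disk"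
      using \<phi>(1) by (simp add: disk_analytic_def analytic_on_open)
    show ?thesis
    proof (cases "\<phi> constant_on unit_disk")
      case True
      \<comment> \<open>A constant symbol, even one of modulus 1, gives the rank-one form with
        evaluation at \<open>a\<close> as the functional.\<close>
      then obtain a where a: "\<And>z. z \<in> unit_disk \<Longrightarrow> \<phi> z = a"
        by (auto simp: constant_on_def)
      have "A p z = fun_scale (poly p a) (A 1) z" for p z
      proof (cases "z \<in> unit_disk")
        case True
        have "A p z = A 1 z * poly p (\<phi> z)"
          using fun_cong[OF fun_cong[OF \<phi>(2)], of p z] by (simp add: mult_op_def comp_op_def)
        then show ?thesis
          using a[OF True] by (simp add: fun_scale_def)
      next
        case False
        then show ?thesis
          using assms(5) by (auto simp: disk_analytic_def fun_scale_def image_subset_iff)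
      qed
      then have "\<forall>p. A p = fun_scale (poly p a) (A 1)"
        by blast
      moreover have "Vector_Spaces.linear smult (*) (\<lambda>p. poly p a)"
        using vector_space_smult by (auto simp: Vector_Spaces.linear_iff vector_space_def algebra_simps)
      ultimately show ?thesis
        using \<phi>(4) by (intro disjI1 bexI[of _ "A 1"] exI[of _ "\<lambda>p. poly p a"] conjI)
    next
      case False
      then have "open (\<phi> ` \<Omega>)"
        using open_mapping_thm[OF hol, of \<Omega>] sub opn by auto
      \<comment> \<open>An open subset of the closed disk lies in its interior.\<close>
      then have "\<phi> ` \<Omega> \<subseteq> unit_disk"
        using interior_maximal[OF \<phi>(3)] by simp
      then show ?thesis
        using \<phi> False by blast
    qed
  qed
qed

end
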